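(* Let $(P,\preceq)$ be a lattice, let $S=\{x_1,\ldots,x_n\}$ be a finite subset of $P$ with distinct elements such that $x_i\preceq x_j\Rightarrow i\leq j$, and let $f_1,\ldots,f_n:P\to\mathbb{C}$. Suppose that $S$ is join closed, and let $k$ be the number of indices $i\in\{1,\ldots,n\}$ with $\Psi_{S,f_i}'(x_i)=0$. Then the following hold for the row-adjusted join matrix $[S]_{f_1,\ldots,f_n}=(f_i(x_i\vee x_j))_{i,j=1}^n$. 1. $\mathrm{rank}\,[S]_{f_1,\ldots,f_n}=0$ if and only if $f_i(x_i\vee x_j)=0$ for all $i,j=1,\ldots,n$. 2. If $k=0$, then $\mathrm{rank}\,[S]_{f_1,\ldots,f_n}=n$. 3. If $k>0$, then $n-k\leq\mathrm{rank}\,[S]_{f_1,\ldots,f_n}\leq n-1$.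
   Context: $S$ is join closed if $x\vee y\in S$ for all $x,y\in S$. For each $i=1,\ldots,n$ the function $\Psi_{S,f_i}':S\to\mathbb{C}$ is defined inductively (downwards) by $$\Psi_{S,f_i}'(x_k)=f_i(x_k)-\sum_{x_k\prec x_v}\Psi_{S,f_i}'(x_v),$$ the sum being over $x_v\in S$; equivalently, $f_i(x_k)=\sum_{x_k\preceq x_v}\Psi_{S,f_i}'(x_v)$ for all $k$. *)

theory Defs
  imports Complex_Main "Jordan_Normal_Form.DL_Rank"
begin

definition join_closed :: "'a::semilattice_sup set \<Rightarrow> bool" where
  "join_closed S \<longleftrightarrow> (\<forall>x\<in>S. \<forall>y\<in>S. sup x y \<in> S)"

text \<open>
  The function \<open>\<Psi>'\<^sub>S\<^sub>,\<^sub>f\<close>, by downward recursion along \<open>S\<close>. The recursion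
  terminates because \<open>S\<close> is finite; for infinite \<open>S\<close> the value is a dummy. Only the
  values at points of \<open>S\<close> are meaningful.
\<close>

function Psi' :: "'a::order set \<Rightarrow> ('a \<Rightarrow> complex) \<Rightarrow> 'a \<Rightarrow> complex" where
  "Psi' S f y = (if finite S then f y - (\<Sum>v\<in>{v \<in> S. y < v}. Psi' S f v) else undefined)"
  by pat_completeness auto
termination
proof (relation "measure (\<lambda>(S, f, y). card {v \<in> S. y < v})")
  fix S :: "'a set" and f :: "'a \<Rightarrow> complex" and y v
  assume "finite S" and "v \<in> {v \<in> S. y < v}"
  then have "{w \<in> S. v < w} \<subset> {w \<in> S. y < w}"
    by (auto dest: less_trans)
  with \<open>finite S\<close> show "((S, f, v), (S, f, y)) \<in> measure (\<lambda>(S, f, y). card {v \<in> S. y < v})"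
    by (auto intro: psubset_card_mono)
qed simp

declare Psi'.simps [simp del]

lemma sum_Psi':
  assumes "finite S" and "y \<in> S"
  shows "f y = (\<Sum>v\<in>{v \<in> S. y \<le> v}. Psi' S f v)"
proof -
  have "{v \<in> S. y \<le> v} = insert y {v \<in> S. y < v}"
    using assms by (auto simp: le_less)
  then show ?thesis
    using assms by (simp add: Psi'.simps [of S f y])
qed

text \<open>
  The elements \<open>x\<^sub>1, \<dots>, x\<^sub>n\<close> and the functions \<open>f\<^sub>1, \<dots>, f\<^sub>n\<close> are indexed from
  \<open>0\<close> to \<open>n - 1\<close>, following the indexing of type \<open>mat\<close>.
\<close>

definition row_adjusted_join_matrix ::
    "nat \<Rightarrow> (nat \<Rightarrow> 'a::semilattice_sup) \<Rightarrow> (nat \<Rightarrow> 'a \<Rightarrow> complex) \<Rightarrow> complex mat" where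
  "row_adjusted_join_matrix n x f = mat n n (\<lambda>(i, j). f i (sup (x i) (x j)))"

end

theory Submission
  imports Defs
begin

text \<open>
  Expanding \<open>f\<^sub>i(x\<^sub>i \<squnion> x\<^sub>j)\<close> as a sum of values of \<open>\<Psi>'\<close> factors the join matrix as \<open>T E\<close>,
  where \<open>E\<close> is the (lower unitriangular) zeta matrix of \<open>S\<close> and \<open>T\<close> is upper triangular with diagonal
  entries \<open>\<Psi>'\<^sub>S\<^sub>,\<^sub>f\<^sub>i(x\<^sub>i)\<close>. Hence the determinant is the product of these entries. If \<open>D\<close> is the
  diagonal 0-1 matrix marking the \<open>k\<close> zero entries, then \<open>(T + D) E\<close> is invertible and \<open>D E\<close> has
  rank at most \<open>k\<close>, so subadditivity of the rank gives the lower bound \<open>n - k\<close>.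
\<close>

text \<open>Split off the rows indexed by \<open>Z\<close> one at a time: a matrix with at most one
  nonzero row has rank at most 1, and rank is subadditive.\<close>

lemma (in vec_space) rank_le_card_nonzero_rows:
  assumes "finite Z" and "A \<in> carrier_mat n nc"
    and "\<And>i j. i < n \<Longrightarrow> j < nc \<Longrightarrow> i \<notin> Z \<Longrightarrow> A $$ (i, j) = 0"
  shows "rank A \<le> card Z"
  using assms
proof (induction Z arbitrary: A rule: finite_induct)
  case empty
  then have "A = 0\<^sub>m n nc"
    by (intro eq_matI) auto
  then show ?case
    by (simp add: rank_0I)
next
  case (insert z Z)
  define B where "B = mat n nc (\<lambda>(i, j). if i = z then 0 else A $$ (i, j))"
  \<comment> \<open>The entries are written as a factor depending on \<open>i\<close> times a factor
    depending on \<open>j\<close>, the outer product form that forces rank at most 1.\<close>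
  define C where "C = mat n nc (\<lambda>(i, j). (if i = z then 1 else 0) * A $$ (z, j))"
  have BC: "B \<in> carrier_mat n nc" "C \<in> carrier_mat n nc"
    by (simp_all add: B_def C_def)
  have "A = B + C"
    using insert.prems(1) by (intro eq_matI) (auto simp: B_def C_def)
  moreover have "rank (B + C) \<le> rank B + rank C"
    using BC by (rule rank_subadditive)
  moreover have "rank B \<le> card Z"
    using insert.prems by (intro insert.IH BC) (auto simp: B_def)
  moreover have "rank C \<le> 1"
    by (rule rank_le_1_product_entries[OF BC(2), of "\<lambda>i. if i = z then 1 else 0" "\<lambda>j. A $$ (z, j)"])
      (simp add: C_def)
  ultimately show ?case
    using insert.hyps by simp
qed

text \<open>A nonzero entry gives a nonzero column, which by itself is a linearly independent set of
  columns and so forces rank at least 1.\<close>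

lemma (in vec_space) rank_eq_0_iff:
  assumes A: "A \<in> carrier_mat n nc"
  shows "rank A = 0 \<longleftrightarrow> A = 0\<^sub>m n nc"
proof
  assume rank: "rank A = 0"
  show "A = 0\<^sub>m n nc"
  proof (rule ccontr)
    assume "A \<noteq> 0\<^sub>m n nc"
    then obtain i j where ij: "i < n" "j < nc" "A $$ (i, j) \<noteq> 0"
      using A by (auto simp: mat_eq_iff)
    have v: "col A j \<in> set (cols A)" "col A j \<in> carrier_vec n" "col A j $ i \<noteq> 0"
      using A ij by (auto simp: cols_def)
    have "lin_indpt {col A j}"
    proof
      assume "lin_dep {col A j}"
      then obtain a where "lincomb a {col A j} = 0\<^sub>v n" "a (col A j) \<noteq> 0"
        using finite_lin_dep[of "{col A j}"] v(2) by auto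
      moreover have "lincomb a {col A j} $ i = a (col A j) * col A j $ i"
        using lincomb_index[OF ij(1), of "{col A j}" a] v(2) by auto
      ultimately show False
        using v(3) ij(1) by simp
    qed
    then have "card {col A j} \<le> rank A"
      using A v(1) by (intro rank_ge_card_indpt) auto
    with rank show False
      by simp
  qed
qed (simp add: rank_0I)

theorem theorem7p2:
  fixes S :: "'a::lattice set"
    and x :: "nat \<Rightarrow> 'a"
    and f :: "nat \<Rightarrow> 'a \<Rightarrow> complex"
    and n k :: nat
  assumes "S = x ` {..<n}"
    and "inj_on x {..<n}"
    and "\<And>i j. i < n \<Longrightarrow> j < n \<Longrightarrow> x i \<le> x j \<Longrightarrow> i \<le> j"
    and "join_closed S"
    and "k = card {i. i < n \<and> Psi' S (f i) (x i) = 0}"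
  shows "(vec_space.rank n (row_adjusted_join_matrix n x f) = 0 \<longleftrightarrow>
            (\<forall>i<n. \<forall>j<n. f i (sup (x i) (x j)) = 0)) \<and>
         (k = 0 \<longrightarrow> vec_space.rank n (row_adjusted_join_matrix n x f) = n) \<and>
         (k > 0 \<longrightarrow> n - k \<le> vec_space.rank n (row_adjusted_join_matrix n x f) \<and>
            vec_space.rank n (row_adjusted_join_matrix n x f) \<le> n - 1)"
proof -
  let ?A = "row_adjusted_join_matrix n x f"
  let ?rank = "vec_space.rank n :: complex mat \<Rightarrow> nat"
  define \<psi> where "\<psi> i v = Psi' S (f i) (x v)" for i v
  define Z where "Z = {i. i < n \<and> \<psi> i i = 0}"
  define E :: "complex mat" where "E = mat n n (\<lambda>(v, j). if x j \<le> x v then 1 else 0)"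
  define T where "T = mat n n (\<lambda>(i, v). if x i \<le> x v then \<psi> i v else 0)"
  define D :: "complex mat" where "D = mat n n (\<lambda>(i, v). if i = v \<and> i \<in> Z then 1 else 0)"
  have carr: "?A \<in> carrier_mat n n" "E \<in> carrier_mat n n" "T \<in> carrier_mat n n" "D \<in> carrier_mat n n"
    by (simp_all add: row_adjusted_join_matrix_def E_def T_def D_def)
  \<comment> \<open>The numbering extends the order of \<open>S\<close>, so the entries of
    \<open>T\<close> below the diagonal and those of \<open>E\<close> above it vanish.\<close>
  have order: "\<not> x i \<le> x j" if "j < i" "i < n" for i j
    using assms(3)[of i j] that by auto
  have k: "k = card Z"
    by (simp add: assms(5) Z_def \<psi>_def)

  have entry: "f i (sup (x i) (x j)) =
      (\<Sum>v = 0..<n. (if x i \<le> x v then \<psi> i v else 0) * (if x j \<le> x v then 1 else 0))"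
    if "i < n" "j < n" for i j
  proof -
    let ?y = "sup (x i) (x j)"
    \<comment> \<open>Join closedness enters here: the expansion by \<open>sum_Psi'\<close> is
      available only at points of \<open>S\<close>.\<close>
    have "?y \<in> S" "finite S"
      using assms(1,4) that by (auto simp: join_closed_def)
    then have "f i ?y = (\<Sum>v\<in>{v \<in> S. ?y \<le> v}. Psi' S (f i) v)"
      using sum_Psi' by blast
    also have "\<dots> = (\<Sum>v\<in>x ` {..<n}. if ?y \<le> v then Psi' S (f i) v else 0)"
      using \<open>finite S\<close> by (simp add: sum.inter_filter flip: assms(1))
    also have "\<dots> = (\<Sum>v<n. if ?y \<le> x v then \<psi> i v else 0)"
      unfolding \<psi>_def using assms(2) by (simp add: sum.reindex)
    \<comment> \<open>By the universal property of the join, \<open>?y \<le> x v\<close> means that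
      both \<open>x i\<close> and \<open>x j\<close> lie below \<open>x v\<close>, so the indicator
      splits into a product.\<close>
    also have "\<dots> = (\<Sum>v = 0..<n. (if x i \<le> x v then \<psi> i v else 0) * (if x j \<le> x v then 1 else 0))"
      by (intro sum.cong) auto
    finally show ?thesis .
  qed
  have A_eq: "?A = T * E"
    by (intro eq_matI)
      (auto simp: row_adjusted_join_matrix_def T_def E_def scalar_prod_def entry intro!: sum.cong)

  have "det E = prod_list (diag_mat E)"
    by (rule det_lower_triangular[OF _ carr(2)]) (simp add: E_def order)
  then have det_E: "det E = 1"
    by (simp add: prod_list_diag_prod E_def)
  have "upper_triangular T"
    using order by (auto simp: T_def)
  then have "det T = (\<Prod>i = 0..<n. \<psi> i i)"
    using det_upper_triangular[of T, OF _ carr(3)] by (simp add: prod_list_diag_prod T_def)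
  then have det_A: "det ?A = (\<Prod>i = 0..<n. \<psi> i i)"
    using carr by (simp add: A_eq det_mult[of _ n] det_E)
  \<comment> \<open>This settles the case \<open>k = 0\<close>; for \<open>k > 0\<close> the rank is
    at most \<open>n\<close> but not equal to it, hence at most \<open>n - 1\<close>.\<close>
  have rank_full_iff: "?rank ?A = n \<longleftrightarrow> Z = {}"
    unfolding vec_space.det_rank_iff[OF carr(1), symmetric] det_A by (auto simp: Z_def)

  have "upper_triangular (T + D)"
    using order by (auto simp: T_def D_def)
  then have "det (T + D) = (\<Prod>i = 0..<n. \<psi> i i + (if i \<in> Z then 1 else 0))"
    using det_upper_triangular[of "T + D" n] by (simp add: prod_list_diag_prod T_def D_def)
  \<comment> \<open>\<open>D\<close> turns exactly the vanishing diagonal entries into 1 and leaves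
    the others alone.\<close>
  moreover have "\<psi> i i + (if i \<in> Z then 1 else 0) \<noteq> 0" if "i < n" for i
    using that by (auto simp: Z_def)
  ultimately have "det ((T + D) * E) \<noteq> 0"
    using carr by (simp add: det_mult[of _ n] det_E)
  then have "n = ?rank ((T + D) * E)"
    using carr by (metis add_carrier_mat mult_carrier_mat vec_space.det_rank_iff)
  also have "(T + D) * E = ?A + D * E"
    using carr by (simp add: A_eq add_mult_distrib_mat[of _ n n])
  also have "?rank (?A + D * E) \<le> ?rank ?A + ?rank (D * E)"
    using carr by (intro vec_space.rank_subadditive) auto
  also have "?rank (D * E) \<le> card Z"
  proof (rule vec_space.rank_le_card_nonzero_rows)
    show "D * E \<in> carrier_mat n n"
      using carr by simp
    \<comment> \<open>Row \<open>i\<close> of \<open>D\<close> is zero for such \<open>i\<close>,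
      hence so is row \<open>i\<close> of the product.\<close>
    show "(D * E) $$ (i, j) = 0" if "i < n" "j < n" "i \<notin> Z" for i j
      using that by (auto simp: D_def E_def scalar_prod_def)
  qed (simp add: Z_def)
  finally have lower: "n - k \<le> ?rank ?A"
    by (simp add: k)

  have "?rank ?A = 0 \<longleftrightarrow> (\<forall>i<n. \<forall>j<n. f i (sup (x i) (x j)) = 0)"
    unfolding vec_space.rank_eq_0_iff[OF carr(1)]
    by (auto simp: row_adjusted_join_matrix_def mat_eq_iff)
  moreover have "k = 0 \<longleftrightarrow> Z = {}"
    by (simp add: k Z_def)
  moreover have "?rank ?A \<le> n"
    using carr(1) by (rule vec_space.rank_le_nc)
  ultimately show ?thesis
    using lower rank_full_iff by auto
qed

end
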